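(* $\mathbf{RPOGrp}$ is a relatively modular quasivariety: for every right-preordered group $(G,P_G)$, the lattice of effective equivalence relations over $(G,P_G)$ in $\mathbf{RPOGrp}$, ordered by inclusion, is a modular lattice.
   Context: A right-preordered group is a pair $(G,P_G)$ with $G$ a group (not necessarily abelian) and $P_G$ a submonoid of $G$ (the positive cone). Morphisms $(G,P_G)\to(H,P_H)$ in $\mathbf{RPOGrp}$ are group homomorphisms $f$ with $f(P_G)\subseteq P_H$. $\mathbf{RPOGrp}$ is a quasivariety, with $(G,P_G)$ having underlying set $G\times P_G$. An effective equivalence relation over $(G,P_G)$ is the kernel pair of some morphism $f$ with domain $(G,P_G)$; concretely it is the right-preordered group $(\{(x,y)\in G\times G\mid f(x)=f(y)\},\ \{(x,y)\in P_G\times P_G\mid f(x)=f(y)\})$. The join of two effective equivalence relations is the smallest effective equivalence relation containing both; the meet is the intersection. A lattice $L$ is modular if $(a\wedge b)\vee(c\wedge b)=((a\wedge b)\vee c)\wedge b$ for all $a,b,c\in L$. *)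

theory Defs
  imports "HOL-Algebra.Algebra"
begin

record 'a rpo_group = "'a monoid" +
  pos_cone :: "'a set"

locale rpo_group = group G + submonoid "pos_cone G" G
  for G :: "('a, 'm) rpo_group_scheme" (structure)

definition rpo_hom ::
    "('a, 'm) rpo_group_scheme \<Rightarrow> ('b, 'n) rpo_group_scheme \<Rightarrow> ('a \<Rightarrow> 'b) set" where
  "rpo_hom G H = {f \<in> hom G H. f ` pos_cone G \<subseteq> pos_cone H}"

definition kernel_pair ::
    "('a, 'm) rpo_group_scheme \<Rightarrow> ('a \<Rightarrow> 'b) \<Rightarrow> ('a \<times> 'a) rpo_group" where
  "kernel_pair G f =
    \<lparr>carrier = {(x, y) \<in> carrier G \<times> carrier G. f x = f y},
     monoid.mult = (\<otimes>\<^bsub>G \<times>\<times> G\<^esub>),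
     one = \<one>\<^bsub>G \<times>\<times> G\<^esub>,
     pos_cone = {(x, y) \<in> pos_cone G \<times> pos_cone G. f x = f y}\<rparr>"

text \<open>A definition cannot quantify over the type of the codomain, so codomains are taken on the
  type \<open>'a set\<close>, where the quotients of \<open>G\<close> live.  Lemma \<open>kernel_pair_effective\<close> below shows
  that kernel pairs of morphisms into codomains on arbitrary types are included.\<close>

definition effective_equivalence_relations ::
    "('a, 'm) rpo_group_scheme \<Rightarrow> ('a \<times> 'a) rpo_group set" where
  "effective_equivalence_relations G =
    {kernel_pair G f | f (H :: 'a set rpo_group). rpo_group H \<and> f \<in> rpo_hom G H}"

text \<open>All kernel pairs over \<open>G\<close> carry the operations of \<open>G \<times>\<times> G\<close>; inclusion therefore
  concerns the two underlying sets.\<close>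

definition effective_equivalence_order ::
    "('a, 'm) rpo_group_scheme \<Rightarrow> ('a \<times> 'a) rpo_group gorder" where
  "effective_equivalence_order G =
    \<lparr>carrier = effective_equivalence_relations G,
     eq = (=),
     le = (\<lambda>R S. carrier R \<subseteq> carrier S \<and> pos_cone R \<subseteq> pos_cone S)\<rparr>"

locale modular_lattice = lattice L for L (structure) +
  assumes modular:
    "\<lbrakk>a \<in> carrier L; b \<in> carrier L; c \<in> carrier L\<rbrakk>
      \<Longrightarrow> (a \<sqinter> b) \<squnion> (c \<sqinter> b) = ((a \<sqinter> b) \<squnion> c) \<sqinter> b"

lemma kernel_pair_cong:
  assumes "rpo_group G"
    and "\<And>x y. x \<in> carrier G \<Longrightarrow> y \<in> carrier G \<Longrightarrow> f x = f y \<longleftrightarrow> g x = g y"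
  shows "kernel_pair G f = kernel_pair G g"
proof -
  interpret rpo_group G by fact
  have "{(x, y) \<in> A \<times> A. f x = f y} = {(x, y) \<in> A \<times> A. g x = g y}"
    if "A \<subseteq> carrier G" for A
    using assms(2) that by blast
  from this[OF order_refl] this[OF subset] show ?thesis
    by (simp only: kernel_pair_def)
qed

lemma group_with_pos_cone:
  assumes "group A"
  shows "group \<lparr>carrier = carrier A, monoid.mult = (\<otimes>\<^bsub>A\<^esub>), one = \<one>\<^bsub>A\<^esub>, pos_cone = P\<rparr>"
proof -
  interpret A: group A by fact
  show ?thesis
    by (rule groupI) (auto simp: A.m_assoc intro: A.l_inv_ex)
qed

lemma (in group_hom) kernel_coset_fibre:
  assumes a: "a \<in> carrier G"
  shows "kernel G H h #>\<^bsub>G\<^esub> a = {b \<in> carrier G. h b = h a}"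
proof (intro equalityI subsetI)
  fix b assume "b \<in> kernel G H h #>\<^bsub>G\<^esub> a"
  then obtain n where "n \<in> carrier G" "h n = \<one>\<^bsub>H\<^esub>" "b = n \<otimes>\<^bsub>G\<^esub> a"
    unfolding r_coset_def kernel_def by blast
  then show "b \<in> {b \<in> carrier G. h b = h a}"
    using a by simp
next
  fix b assume b: "b \<in> {b \<in> carrier G. h b = h a}"
  then have "b \<otimes>\<^bsub>G\<^esub> inv\<^bsub>G\<^esub> a \<in> kernel G H h"
    using a by (simp add: kernel_def)
  moreover have "b = (b \<otimes>\<^bsub>G\<^esub> inv\<^bsub>G\<^esub> a) \<otimes>\<^bsub>G\<^esub> a"
    using a b by (simp add: G.m_assoc)
  ultimately show "b \<in> kernel G H h #>\<^bsub>G\<^esub> a"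
    unfolding r_coset_def by blast
qed

lemma kernel_pair_effective:
  fixes H :: "('b, 'n) rpo_group_scheme"
  assumes G: "rpo_group (G :: ('a, 'm) rpo_group_scheme)"
    and H: "rpo_group H" and f: "f \<in> rpo_hom G H"
  shows "kernel_pair G f \<in> effective_equivalence_relations G"
proof -
  interpret G: rpo_group G by fact
  interpret H: rpo_group H by fact
  interpret f: group_hom G H f
    using f by unfold_locales (simp add: rpo_hom_def)
  define N where "N = kernel G H f"
  interpret N: normal N G unfolding N_def by (rule f.normal_kernel)
  define q where "q = (\<lambda>x. N #>\<^bsub>G\<^esub> x)"
  have q: "q \<in> hom G (G Mod N)" unfolding q_def by (rule N.r_coset_hom_Mod)
  define Q :: "'a set rpo_group" where
    "Q = \<lparr>carrier = carrier (G Mod N), monoid.mult = (\<otimes>\<^bsub>G Mod N\<^esub>), one = \<one>\<^bsub>G Mod N\<^esub>,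
          pos_cone = q ` pos_cone G\<rparr>"
  have "group (G Mod N)" by (rule N.factorgroup_is_group)
  then have "group Q"
    unfolding Q_def by (rule group_with_pos_cone)
  moreover have "submonoid (pos_cone Q) Q"
  proof
    show "pos_cone Q \<subseteq> carrier Q"
      using q G.mem_carrier by (auto simp: Q_def hom_def)
    show "x \<otimes>\<^bsub>Q\<^esub> y \<in> pos_cone Q" if xy: "x \<in> pos_cone Q" "y \<in> pos_cone Q" for x y
    proof -
      obtain a b where ab: "a \<in> pos_cone G" "b \<in> pos_cone G" "x = q a" "y = q b"
        using xy by (auto simp: Q_def)
      then have "x \<otimes>\<^bsub>Q\<^esub> y = q (a \<otimes>\<^bsub>G\<^esub> b)"
        using hom_mult[OF q] by (simp add: Q_def)
      then show ?thesis using ab by (simp add: Q_def)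
    qed
    have "\<one>\<^bsub>Q\<^esub> = q \<one>\<^bsub>G\<^esub>"
      using G.coset_mult_one[OF N.subset] by (simp add: Q_def q_def FactGroup_def)
    then show "\<one>\<^bsub>Q\<^esub> \<in> pos_cone Q" by (simp add: Q_def)
  qed
  ultimately have "rpo_group Q" by (simp add: rpo_group_def)
  moreover have "q \<in> rpo_hom G Q"
    using q by (simp add: rpo_hom_def Q_def hom_def)
  moreover have "kernel_pair G f = kernel_pair G q"
  proof (rule kernel_pair_cong[OF G])
    fix x y assume xy: "x \<in> carrier G" "y \<in> carrier G"
    have fibre: "q a = {b \<in> carrier G. f b = f a}" if "a \<in> carrier G" for a
      unfolding q_def N_def by (rule f.kernel_coset_fibre[OF that])
    show "f x = f y \<longleftrightarrow> q x = q y"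
      using xy by (auto simp: fibre)
  qed
  ultimately show ?thesis
    unfolding effective_equivalence_relations_def by blast
qed

lemma effective_equivalence_meet:
  assumes G: "rpo_group G"
    and R: "R \<in> effective_equivalence_relations G"
    and S: "S \<in> effective_equivalence_relations G"
  shows "carrier (R \<sqinter>\<^bsub>effective_equivalence_order G\<^esub> S) = carrier R \<inter> carrier S"
    and "pos_cone (R \<sqinter>\<^bsub>effective_equivalence_order G\<^esub> S) = pos_cone R \<inter> pos_cone S"
proof -
  let ?L = "effective_equivalence_order G"
  obtain f H where f: "rpo_group (H :: 'a set rpo_group)" "f \<in> rpo_hom G H" "R = kernel_pair G f"
    using R unfolding effective_equivalence_relations_def by auto
  obtain g K where g: "rpo_group (K :: 'a set rpo_group)" "g \<in> rpo_hom G K" "S = kernel_pair G g"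
    using S unfolding effective_equivalence_relations_def by auto
  interpret H: rpo_group H by fact
  interpret K: rpo_group K by fact
  define P where "P = \<lparr>carrier = carrier (H \<times>\<times> K), monoid.mult = (\<otimes>\<^bsub>H \<times>\<times> K\<^esub>),
    one = \<one>\<^bsub>H \<times>\<times> K\<^esub>, pos_cone = pos_cone H \<times> pos_cone K\<rparr>"
  define h where "h = (\<lambda>x. (f x, g x))"
  have "group (H \<times>\<times> K)" by (rule DirProd_group[OF H.group_axioms K.group_axioms])
  then have "group P"
    unfolding P_def by (rule group_with_pos_cone)
  moreover have "submonoid (pos_cone P) P"
    by unfold_locales (auto simp: P_def)
  ultimately have "rpo_group P" by (simp add: rpo_group_def)
  moreover have "h \<in> rpo_hom G P"
    using f(2) g(2) by (auto simp: rpo_hom_def P_def h_def hom_def)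
  ultimately have T: "kernel_pair G h \<in> effective_equivalence_relations G"
    by (rule kernel_pair_effective[OF G])
  have sets: "carrier (kernel_pair G h) = carrier R \<inter> carrier S"
    "pos_cone (kernel_pair G h) = pos_cone R \<inter> pos_cone S"
    by (auto simp: f(3) g(3) h_def kernel_pair_def)
  have T_greatest: "greatest ?L (kernel_pair G h) (Lower ?L {R, S})"
    using T R S by (auto simp: greatest_def Lower_def effective_equivalence_order_def sets)
  have "greatest ?L (R \<sqinter>\<^bsub>?L\<^esub> S) (Lower ?L {R, S})"
    unfolding meet_def Lattice.inf_def
    using someI[where P = "\<lambda>T. greatest ?L T (Lower ?L {R, S})", OF T_greatest] .
  then have "le ?L (R \<sqinter>\<^bsub>?L\<^esub> S) (kernel_pair G h)" "le ?L (kernel_pair G h) (R \<sqinter>\<^bsub>?L\<^esub> S)"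
    using T_greatest unfolding greatest_def by blast+
  then have "carrier (R \<sqinter>\<^bsub>?L\<^esub> S) = carrier (kernel_pair G h)
      \<and> pos_cone (R \<sqinter>\<^bsub>?L\<^esub> S) = pos_cone (kernel_pair G h)"
    by (simp add: effective_equivalence_order_def subset_antisym)
  then show "carrier (R \<sqinter>\<^bsub>?L\<^esub> S) = carrier R \<inter> carrier S"
    and "pos_cone (R \<sqinter>\<^bsub>?L\<^esub> S) = pos_cone R \<inter> pos_cone S"
    by (simp_all add: sets)
qed

end

(* Kernel pairs of morphisms out of G correspond to the normal subgroups of G, and since the
   positive cone of a kernel pair is determined by its carrier, this is an order isomorphism.
   The lattice is therefore that of normal subgroups, with join the product of subgroups,
   and modularity is Dedekind's law. *)

theory Submission
  imports Defs
begin

text \<open>If \<open>x = a \<otimes> c\<close> lies in \<open>H\<close> and \<open>a\<close> does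
  too, then so does \<open>c = inv a \<otimes> x\<close>; hence the factorisation of
  \<open>x\<close> already takes place with second factor in \<open>C \<inter> H\<close>.\<close>

lemma (in subgroup) dedekind_set_mult:
  assumes "group G" "A \<subseteq> H" "C \<subseteq> carrier G"
  shows "A <#> (C \<inter> H) = (A <#> C) \<inter> H"
proof (intro equalityI subsetI)
  fix x assume "x \<in> A <#> (C \<inter> H)"
  then show "x \<in> (A <#> C) \<inter> H"
    using assms(2) unfolding set_mult_def by blast
next
  fix x assume "x \<in> (A <#> C) \<inter> H"
  then obtain a c where ac: "a \<in> A" "c \<in> C" "x = a \<otimes> c" "x \<in> H"
    unfolding set_mult_def by blast
  interpret group G by fact
  have "a \<in> carrier G" "c \<in> carrier G"
    using ac(1,2) assms(2,3) by auto
  then have "c = inv a \<otimes> x"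
    using ac(3) by (simp add: inv_solve_left)
  moreover have "inv a \<otimes> x \<in> H"
    using ac(1,4) assms(2) by auto
  ultimately show "x \<in> A <#> (C \<inter> H)"
    using ac(1-3) unfolding set_mult_def by blast
qed

text \<open>Conjugation is multiplicative, so the conjugate of a product
  \<open>m \<otimes> n\<close> is the product of the conjugates, which stay in \<open>M\<close> and
  \<open>N\<close>.\<close>

lemma (in group) normal_set_mult:
  assumes "M \<lhd> G" "N \<lhd> G"
  shows "M <#> N \<lhd> G"
proof (rule normal_invI)
  interpret M: normal M G by fact
  interpret N: normal N G by fact
  show "subgroup (M <#> N) G"
    using assms(1) N.subgroup_axioms by (rule mult_norm_subgroup)
  fix x h assume x: "x \<in> carrier G" and "h \<in> M <#> N"
  then obtain m n where mn: "m \<in> M" "n \<in> N" "h = m \<otimes> n"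
    unfolding set_mult_def by blast
  \<comment> \<open>The cancellation between the two conjugates, in the right-nested form that
    \<open>m_assoc\<close> produces.\<close>
  have "inv x \<otimes> (x \<otimes> (n \<otimes> inv x)) = n \<otimes> inv x"
    using x mn(2) by (simp flip: m_assoc)
  then have "x \<otimes> h \<otimes> inv x = (x \<otimes> m \<otimes> inv x) \<otimes> (x \<otimes> n \<otimes> inv x)"
    using x mn by (simp add: m_assoc)
  then show "x \<otimes> h \<otimes> inv x \<in> M <#> N"
    using M.inv_op_closed2[OF x mn(1)] N.inv_op_closed2[OF x mn(2)]
    unfolding set_mult_def by blast
qed

text \<open>For normal \<open>N\<close> this is the congruence modulo \<open>N\<close>, the kernel
  pair of the quotient map. It is the normal form to which every effective equivalence relation is
  reduced.\<close>

definition coset_kernel_pair ::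
    "('a, 'm) rpo_group_scheme \<Rightarrow> 'a set \<Rightarrow> ('a \<times> 'a) rpo_group" where
  "coset_kernel_pair G N = kernel_pair G (\<lambda>x. N #>\<^bsub>G\<^esub> x)"

context rpo_group
begin

abbreviation "EER \<equiv> effective_equivalence_order G"

lemma coset_kernel_pair_effective:
  assumes "N \<lhd> G"
  shows "coset_kernel_pair G N \<in> effective_equivalence_relations G"
proof -
  interpret N: normal N G by fact
  \<comment> \<open>A kernel pair does not depend on the cone of the codomain, so the quotient gets
    the largest one; the quotient map then preserves cones trivially.\<close>
  define Q :: "'a set rpo_group" where
    "Q = \<lparr>carrier = carrier (G Mod N), monoid.mult = (\<otimes>\<^bsub>G Mod N\<^esub>), one = \<one>\<^bsub>G Mod N\<^esub>,
          pos_cone = carrier (G Mod N)\<rparr>"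
  interpret Q: group Q
    unfolding Q_def by (rule group_with_pos_cone[OF N.factorgroup_is_group])
  have "submonoid (pos_cone Q) Q"
    using Q.m_closed Q.one_closed by unfold_locales (auto simp: Q_def)
  then have "rpo_group Q"
    by (simp add: rpo_group_def Q.group_axioms)
  moreover have "(\<lambda>x. N #> x) \<in> rpo_hom G Q"
    using N.r_coset_hom_Mod mem_carrier by (auto simp: rpo_hom_def Q_def hom_def)
  ultimately show ?thesis
    unfolding coset_kernel_pair_def by (rule kernel_pair_effective[OF rpo_group_axioms])
qed

text \<open>The fibres of \<open>f\<close> are the cosets of its kernel, so \<open>f\<close> and the
  quotient map by the kernel identify the same elements.\<close>

lemma kernel_pair_eq_coset_kernel_pair:
  assumes "group H" "f \<in> hom G H"
  shows "kernel_pair G f = coset_kernel_pair G (kernel G H f)"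
  unfolding coset_kernel_pair_def
proof (rule kernel_pair_cong[OF rpo_group_axioms])
  interpret f: group_hom G H f
    using assms by (simp add: group_hom_def group_hom_axioms_def group_axioms)
  fix x y assume "x \<in> carrier G" "y \<in> carrier G"
  then show "f x = f y \<longleftrightarrow> kernel G H f #> x = kernel G H f #> y"
    by (auto simp: f.kernel_coset_fibre)
qed

text \<open>Replaces the quantification over morphisms and codomains by one over normal
  subgroups.\<close>

lemma effective_equivalence_relations_eq:
  "effective_equivalence_relations G = coset_kernel_pair G ` {N. N \<lhd> G}"
proof (intro equalityI subsetI)
  fix R assume "R \<in> effective_equivalence_relations G"
  then obtain f H where f: "rpo_group (H :: 'a set rpo_group)" "f \<in> rpo_hom G H"
      "R = kernel_pair G f"
    unfolding effective_equivalence_relations_def by auto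
  interpret H: rpo_group H by fact
  interpret f: group_hom G H f
    using f(2) by unfold_locales (simp add: rpo_hom_def)
  show "R \<in> coset_kernel_pair G ` {N. N \<lhd> G}"
    using f(3) kernel_pair_eq_coset_kernel_pair[OF H.group_axioms f.homh] f.normal_kernel by blast
qed (auto intro: coset_kernel_pair_effective)

text \<open>The subgroup is recovered from the carrier as the class of \<open>\<one>\<close>, so
  inclusion of carriers already forces \<open>M \<subseteq> N\<close>. Conversely, equality of
  cosets means \<open>x \<otimes> inv y\<close> lies in the subgroup, a condition that is monotone
  in the subgroup.\<close>

lemma coset_kernel_pair_le_iff:
  assumes M: "M \<lhd> G" and N: "N \<lhd> G"
  shows "coset_kernel_pair G M \<sqsubseteq>\<^bsub>EER\<^esub> coset_kernel_pair G N \<longleftrightarrow> M \<subseteq> N"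
proof -
  interpret M: normal M G by fact
  interpret N: normal N G by fact
  have coset_eq: "K #> x = K #> y \<longleftrightarrow> x \<otimes> inv y \<in> K"
    if "K \<lhd> G" "x \<in> carrier G" "y \<in> carrier G" for K x y
  proof -
    interpret K: normal K G by fact
    show ?thesis
      using that(2,3) K.rcos_module[OF group_axioms that(3,2)] repr_independence[of x K y]
        rcos_self[OF that(2) K.subgroup_axioms] K.subgroup_axioms by metis
  qed
  show ?thesis
  proof
    assume le: "coset_kernel_pair G M \<sqsubseteq>\<^bsub>EER\<^esub> coset_kernel_pair G N"
    show "M \<subseteq> N"
    proof
      fix x assume "x \<in> M"
      then have "(x, \<one>) \<in> carrier (coset_kernel_pair G M)"
        by (simp add: coset_kernel_pair_def kernel_pair_def coset_eq[OF M])
      then have "(x, \<one>) \<in> carrier (coset_kernel_pair G N)"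
        using le by (auto simp: effective_equivalence_order_def)
      then have x: "x \<in> carrier G" "N #> x = N #> \<one>"
        by (auto simp: coset_kernel_pair_def kernel_pair_def)
      from coset_eq[OF N x(1), of \<one>] x show "x \<in> N"
        by simp
    qed
  next
    assume "M \<subseteq> N"
    then have "N #> x = N #> y" if "x \<in> carrier G" "y \<in> carrier G" "M #> x = M #> y" for x y
      using that coset_eq[OF M that(1,2)] coset_eq[OF N that(1,2)] by auto
    \<comment> \<open>Stated for arbitrary \<open>S\<close> so that it serves both the carrier and
      the positive cone.\<close>
    then have "{(x, y) \<in> S \<times> S. M #> x = M #> y} \<subseteq> {(x, y) \<in> S \<times> S. N #> x = N #> y}"
      if "S \<subseteq> carrier G" for S
      using that by blast
    from this[OF order_refl] this[OF subset]
    show "coset_kernel_pair G M \<sqsubseteq>\<^bsub>EER\<^esub> coset_kernel_pair G N"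
      by (simp only: effective_equivalence_order_def coset_kernel_pair_def kernel_pair_def
          gorder.simps partial_object.simps rpo_group.simps)
  qed
qed

lemma carrier_EER: "carrier EER = coset_kernel_pair G ` {N. N \<lhd> G}"
  by (simp add: effective_equivalence_order_def effective_equivalence_relations_eq)

lemma EER_partial_order: "partial_order EER"
proof -
  \<comment> \<open>The order compares only carriers and cones, whereas antisymmetry asks for equal
    records. Mutual inclusion yields the same normal subgroup, hence the same record.\<close>
  have antisym: "R = S"
    if "R \<in> carrier EER" "S \<in> carrier EER" "R \<sqsubseteq>\<^bsub>EER\<^esub> S" "S \<sqsubseteq>\<^bsub>EER\<^esub> R" for R S
    using that by (auto simp: carrier_EER coset_kernel_pair_le_iff)
  have eq: "(.=\<^bsub>EER\<^esub>) = (=)"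
    by (simp add: effective_equivalence_order_def)
  show ?thesis
    by unfold_locales (auto simp: eq intro: antisym, auto simp: effective_equivalence_order_def)
qed

text \<open>Since each factor contains \<open>\<one>\<close>, the product contains \<open>M\<close>
  and \<open>N\<close>; any normal subgroup containing both is closed under multiplication and so
  contains the product.\<close>

lemma coset_kernel_pair_least_Upper:
  assumes M: "M \<lhd> G" and N: "N \<lhd> G"
  shows "least EER (coset_kernel_pair G (M <#> N))
    (Upper EER {coset_kernel_pair G M, coset_kernel_pair G N})"
proof (rule least_UpperI)
  interpret M: normal M G by fact
  interpret N: normal N G by fact
  have MN: "M <#> N \<lhd> G" by (rule normal_set_mult[OF M N])
  have "M \<subseteq> M <#> N"
  proof
    fix m assume "m \<in> M"
    then have "m = m \<otimes> \<one>" by simp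
    then show "m \<in> M <#> N"
      using \<open>m \<in> M\<close> N.one_closed unfolding set_mult_def by blast
  qed
  moreover have "N \<subseteq> M <#> N"
  proof
    fix n assume "n \<in> N"
    then have "n = \<one> \<otimes> n" by simp
    then show "n \<in> M <#> N"
      using \<open>n \<in> N\<close> M.one_closed unfolding set_mult_def by blast
  qed
  ultimately show "R \<sqsubseteq>\<^bsub>EER\<^esub> coset_kernel_pair G (M <#> N)"
    if "R \<in> {coset_kernel_pair G M, coset_kernel_pair G N}" for R
    using that by (auto simp: coset_kernel_pair_le_iff M N MN)
  show "coset_kernel_pair G (M <#> N) \<sqsubseteq>\<^bsub>EER\<^esub> R"
    if R: "R \<in> Upper EER {coset_kernel_pair G M, coset_kernel_pair G N}" for R
  proof -
    obtain K where K: "K \<lhd> G" "R = coset_kernel_pair G K"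
      using R by (auto simp: Upper_def carrier_EER)
    then have "M \<subseteq> K" "N \<subseteq> K"
      using R M N by (auto simp: Upper_def carrier_EER coset_kernel_pair_le_iff)
    then have "M <#> N \<subseteq> K"
      using normal_imp_subgroup[OF K(1)] by (auto simp: set_mult_def subset_iff subgroup.m_closed)
    then show ?thesis
      using K by (simp add: coset_kernel_pair_le_iff MN)
  qed
  show "{coset_kernel_pair G M, coset_kernel_pair G N} \<subseteq> carrier EER"
    "coset_kernel_pair G (M <#> N) \<in> carrier EER"
    using M N MN by (auto simp: carrier_EER)
qed

lemma coset_kernel_pair_greatest_Lower:
  assumes M: "M \<lhd> G" and N: "N \<lhd> G"
  shows "greatest EER (coset_kernel_pair G (M \<inter> N))
    (Lower EER {coset_kernel_pair G M, coset_kernel_pair G N})"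
  using M N normal_subgroup_intersect[OF M N]
  by (auto simp: greatest_def Lower_def carrier_EER coset_kernel_pair_le_iff)

lemma EER_lattice: "lattice EER"
proof -
  interpret partial_order EER by (rule EER_partial_order)
  show ?thesis
    by unfold_locales
      (auto simp: carrier_EER intro: coset_kernel_pair_least_Upper coset_kernel_pair_greatest_Lower)
qed

text \<open>The join is a chosen least upper bound; uniqueness in the partial order identifies it
  with the explicit one. The meet is treated dually.\<close>

lemma coset_kernel_pair_join:
  assumes "M \<lhd> G" "N \<lhd> G"
  shows "coset_kernel_pair G M \<squnion>\<^bsub>EER\<^esub> coset_kernel_pair G N = coset_kernel_pair G (M <#> N)"
proof -
  interpret L: lattice EER by (rule EER_lattice)
  show ?thesis
    unfolding join_def
    by (rule L.least_unique[OF L.sup_of_two_least coset_kernel_pair_least_Upper])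
      (use assms in \<open>auto simp: carrier_EER\<close>)
qed

lemma coset_kernel_pair_meet:
  assumes "M \<lhd> G" "N \<lhd> G"
  shows "coset_kernel_pair G M \<sqinter>\<^bsub>EER\<^esub> coset_kernel_pair G N = coset_kernel_pair G (M \<inter> N)"
proof -
  interpret L: lattice EER by (rule EER_lattice)
  show ?thesis
    unfolding meet_def
    by (rule L.greatest_unique[OF L.inf_of_two_greatest coset_kernel_pair_greatest_Lower])
      (use assms in \<open>auto simp: carrier_EER\<close>)
qed

end

theorem mainTheorem6:
  fixes G :: "('a, 'm) rpo_group_scheme"
  assumes "rpo_group G"
  shows "modular_lattice (effective_equivalence_order G)"
proof -
  interpret rpo_group G by fact
  interpret lattice EER by (rule EER_lattice)
  show ?thesis
  proof
    fix a b c assume "a \<in> carrier EER" "b \<in> carrier EER" "c \<in> carrier EER"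
    then obtain A B C where N: "A \<lhd> G" "B \<lhd> G" "C \<lhd> G"
      and abc: "a = coset_kernel_pair G A" "b = coset_kernel_pair G B" "c = coset_kernel_pair G C"
      by (auto simp: carrier_EER)
    \<comment> \<open>Dedekind's law inside the subgroup \<open>B\<close>, applicable because
      \<open>A \<inter> B\<close> is contained in \<open>B\<close>.\<close>
    have "(A \<inter> B) <#>\<^bsub>G\<^esub> (C \<inter> B) = ((A \<inter> B) <#>\<^bsub>G\<^esub> C) \<inter> B"
      using N group_axioms
      by (intro subgroup.dedekind_set_mult) (auto dest: normal_imp_subgroup subgroup.subset)
    then show "(a \<sqinter>\<^bsub>EER\<^esub> b) \<squnion>\<^bsub>EER\<^esub> (c \<sqinter>\<^bsub>EER\<^esub> b) = ((a \<sqinter>\<^bsub>EER\<^esub> b) \<squnion>\<^bsub>EER\<^esub> c) \<sqinter>\<^bsub>EER\<^esub> b"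
      by (simp add: abc coset_kernel_pair_join coset_kernel_pair_meet N
          normal_subgroup_intersect normal_set_mult)
  qed
qed

end
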